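(* Let $A$ be a residuated lattice with reticulation $(\mathcal{L}(A),\lambda)$, and let $F$ be a filter of $A$. Then the following are equivalent: (1) the filter $F$ has the Boolean Lifting Property (BLP) in $A$; (2) the filter $\lambda(F)=\{\lambda(a)\mid a\in F\}$ has the Boolean Lifting Property (BLP) in $\mathcal{L}(A)$.
   Context: A residuated lattice is an algebra $(A,\vee,\wedge,\odot,\rightarrow,0,1)$ such that $(A,\vee,\wedge,0,1)$ is a bounded lattice (with order $\leq$), $(A,\odot,1)$ is a commutative monoid, and $a\leq b\rightarrow c$ iff $a\odot b\leq c$ for all $a,b,c$. Put $a\leftrightarrow b=(a\rightarrow b)\wedge(b\rightarrow a)$; $a^n$ is the $n$-fold $\odot$-power and $\mathbb{N}^*$ the nonzero naturals. For a residuated lattice or a bounded distributive lattice $X$, $\mathcal{B}(X)$ is the set of complemented elements of the underlying bounded lattice. A filter of a residuated lattice $A$ is a non-empty subset closed under $\odot$ and upward closed; for a filter $F$, the congruence modulo $F$ is $x\equiv y$ iff $x\leftrightarrow y\in F$. A filter of a bounded distributive lattice $L$ is a non-empty subset closed under $\wedge$ and upward closed; for a filter $F$, the congruence modulo $F$ is $x\equiv y$ iff $x\wedge a=y\wedge a$ for some $a\in F$. In either case $X/F$ is the quotient algebra, $x/F$ the class of $x$, $\mathcal{B}(X)/F=\{e/F\mid e\in\mathcal{B}(X)\}$; $F$ has BLP in $X$ iff $\mathcal{B}(X/F)=\mathcal{B}(X)/F$. The reticulation of $A$ is a pair $(\mathcal{L}(A),\lambda)$, unique up to bounded lattice isomorphism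 (compatible with $\lambda$), where $\mathcal{L}(A)$ is a bounded distributive lattice and $\lambda:A\to\mathcal{L}(A)$ is a surjection with $\lambda(a\odot b)=\lambda(a)\wedge\lambda(b)$, $\lambda(a\vee b)=\lambda(a)\vee\lambda(b)$, $\lambda(0)=0$, $\lambda(1)=1$, and $\lambda(a)\leq\lambda(b)$ iff $a^n\leq b$ for some $n\in\mathbb{N}^*$. For every filter $F$ of $A$, $\lambda(F)$ is a filter of $\mathcal{L}(A)$. *)

theory Defs
  imports Main
begin

text \<open>The unit of the monoid is required to be the top of the lattice, so that the \<open>n\<close>-fold
  product of \<open>a\<close> is the library power \<open>a ^ n\<close>. The trivial algebra with \<open>bot = top\<close> is allowed.\<close>

class residuated_lattice = bounded_lattice + comm_monoid_mult +
  fixes res_imp :: "'a \<Rightarrow> 'a \<Rightarrow> 'a"  (infixr "\<leadsto>" 65)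
  assumes one_eq_top: "1 = top"
    and residuation: "a \<le> (b \<leadsto> c) \<longleftrightarrow> a * b \<le> c"

definition res_iff :: "'a::residuated_lattice \<Rightarrow> 'a \<Rightarrow> 'a" where
  "res_iff a b = inf (a \<leadsto> b) (b \<leadsto> a)"

definition complemented_elements ::
  "'a set \<Rightarrow> ('a \<Rightarrow> 'a \<Rightarrow> 'a) \<Rightarrow> ('a \<Rightarrow> 'a \<Rightarrow> 'a) \<Rightarrow> 'a \<Rightarrow> 'a \<Rightarrow> 'a set" where
  "complemented_elements C join meet zero one =
     {x \<in> C. \<exists>y \<in> C. join x y = one \<and> meet x y = zero}"

definition boolean_center :: "'a::bounded_lattice set" where
  "boolean_center = complemented_elements UNIV sup inf bot top"

text \<open>The operation induced by \<open>f\<close> on the classes of \<open>\<theta>\<close>. If \<open>\<theta>\<close> is compatible with \<open>f\<close>, it maps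
  the classes of \<open>x\<close> and \<open>y\<close> to the class of \<open>f x y\<close>; see \<open>quot_op_class\<close>.\<close>

definition quot_op :: "'a rel \<Rightarrow> ('a \<Rightarrow> 'a \<Rightarrow> 'a) \<Rightarrow> 'a set \<Rightarrow> 'a set \<Rightarrow> 'a set" where
  "quot_op \<theta> f X Y = (\<Union>x\<in>X. \<Union>y\<in>Y. \<theta> `` {f x y})"

text \<open>Complementation only involves the bounded lattice reduct of a quotient algebra, so the
  other operations of the quotient are not needed.\<close>

definition quot_boolean_center :: "'a::bounded_lattice rel \<Rightarrow> 'a set set" where
  "quot_boolean_center \<theta> =
     complemented_elements (UNIV // \<theta>) (quot_op \<theta> sup) (quot_op \<theta> inf) (\<theta> `` {bot}) (\<theta> `` {top})"

definition lifts_boolean_center :: "'a::bounded_lattice rel \<Rightarrow> bool" where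
  "lifts_boolean_center \<theta> \<longleftrightarrow> quot_boolean_center \<theta> = (\<lambda>e. \<theta> `` {e}) ` boolean_center"

definition rl_filter :: "'a::residuated_lattice set \<Rightarrow> bool" where
  "rl_filter F \<longleftrightarrow> F \<noteq> {} \<and> (\<forall>a\<in>F. \<forall>b\<in>F. a * b \<in> F) \<and> (\<forall>a\<in>F. \<forall>b. a \<le> b \<longrightarrow> b \<in> F)"

definition rl_cong :: "'a::residuated_lattice set \<Rightarrow> 'a rel" where
  "rl_cong F = {(x, y). res_iff x y \<in> F}"

definition rl_BLP :: "'a::residuated_lattice set \<Rightarrow> bool" where
  "rl_BLP F \<longleftrightarrow> lifts_boolean_center (rl_cong F)"

definition lat_filter :: "'a::{distrib_lattice, bounded_lattice} set \<Rightarrow> bool" where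
  "lat_filter F \<longleftrightarrow> F \<noteq> {} \<and> (\<forall>a\<in>F. \<forall>b\<in>F. inf a b \<in> F) \<and> (\<forall>a\<in>F. \<forall>b. a \<le> b \<longrightarrow> b \<in> F)"

definition lat_cong :: "'a::{distrib_lattice, bounded_lattice} set \<Rightarrow> 'a rel" where
  "lat_cong F = {(x, y). \<exists>a\<in>F. inf x a = inf y a}"

definition lat_BLP :: "'a::{distrib_lattice, bounded_lattice} set \<Rightarrow> bool" where
  "lat_BLP F \<longleftrightarrow> lifts_boolean_center (lat_cong F)"

definition is_reticulation ::
  "('a::residuated_lattice \<Rightarrow> 'b::{distrib_lattice, bounded_lattice}) \<Rightarrow> bool" where
  "is_reticulation lam \<longleftrightarrow>
     surj lam \<and>
     (\<forall>a b. lam (a * b) = inf (lam a) (lam b)) \<and>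
     (\<forall>a b. lam (sup a b) = sup (lam a) (lam b)) \<and>
     lam bot = bot \<and> lam top = top \<and>
     (\<forall>a b. lam a \<le> lam b \<longleftrightarrow> (\<exists>n. n \<noteq> 0 \<and> a ^ n \<le> b))"

text \<open>The quotient operations are well defined.\<close>

lemma quot_op_class:
  assumes eq: "equiv UNIV \<theta>"
    and comp: "\<And>x x' y y'. (x, x') \<in> \<theta> \<Longrightarrow> (y, y') \<in> \<theta> \<Longrightarrow> (f x y, f x' y') \<in> \<theta>"
  shows "quot_op \<theta> f (\<theta> `` {x}) (\<theta> `` {y}) = \<theta> `` {f x y}"
proof -
  have "\<theta> `` {f x' y'} = \<theta> `` {f x y}" if "x' \<in> \<theta> `` {x}" "y' \<in> \<theta> `` {y}" for x' y'
    using that comp[of x x' y y'] eq by (metis Image_singleton_iff equiv_class_eq)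
  moreover have "x \<in> \<theta> `` {x}" "y \<in> \<theta> `` {y}"
    using eq by (auto simp: equiv_def refl_on_def)
  ultimately show ?thesis unfolding quot_op_def by blast
qed

lemma lat_cong_equiv:
  assumes F: "lat_filter F"
  shows "equiv UNIV (lat_cong F)"
proof (rule equivI)
  show "refl (lat_cong F)"
    using F by (auto simp: refl_on_def lat_cong_def lat_filter_def)
  show "sym (lat_cong F)"
    by (auto simp: sym_def lat_cong_def) metis
  show "trans (lat_cong F)"
  proof (rule transI)
    fix x y z assume "(x, y) \<in> lat_cong F" "(y, z) \<in> lat_cong F"
    then obtain a b where ab: "a \<in> F" "b \<in> F" "inf x a = inf y a" "inf y b = inf z b"
      by (auto simp: lat_cong_def)
    have "inf x (inf a b) = inf z (inf a b)"
      using ab(3,4) by (metis inf.assoc inf.commute)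
    moreover have "inf a b \<in> F" using F ab by (auto simp: lat_filter_def)
    ultimately show "(x, z) \<in> lat_cong F" by (auto simp: lat_cong_def)
  qed
qed simp

lemma lat_cong_compatible:
  assumes F: "lat_filter F" and xy: "(x, x') \<in> lat_cong F" "(y, y') \<in> lat_cong F"
  shows "(sup x y, sup x' y') \<in> lat_cong F" and "(inf x y, inf x' y') \<in> lat_cong F"
proof -
  obtain a b where ab: "a \<in> F" "b \<in> F" "inf x a = inf x' a" "inf y b = inf y' b"
    using xy by (auto simp: lat_cong_def)
  have c: "inf a b \<in> F" using F ab by (auto simp: lat_filter_def)
  have 1: "inf x (inf a b) = inf x' (inf a b)" using ab(3) by (metis inf.assoc)
  have 2: "inf y (inf a b) = inf y' (inf a b)" using ab(4) by (metis inf.assoc inf.commute)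
  have "inf (sup x y) (inf a b) = inf (sup x' y') (inf a b)"
    by (simp only: inf_sup_distrib2 1 2)
  then show "(sup x y, sup x' y') \<in> lat_cong F" using c by (auto simp: lat_cong_def)
  have "inf (inf x y) (inf a b) = inf (inf x' y') (inf a b)"
    using 1 2 by (metis inf.assoc inf.commute)
  then show "(inf x y, inf x' y') \<in> lat_cong F" using c by (auto simp: lat_cong_def)
qed

lemma rl_mult_mono:
  fixes a b c :: "'a::residuated_lattice"
  assumes "a \<le> b"
  shows "a * c \<le> b * c"
proof -
  have "b \<le> c \<leadsto> b * c" by (simp add: residuation)
  then have "a \<le> c \<leadsto> b * c" using assms by (rule order_trans[rotated])
  then show ?thesis by (simp add: residuation)
qed

lemma rl_mult_le:
  fixes a b :: "'a::residuated_lattice"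
  shows "a * b \<le> a" and "a * b \<le> b"
proof -
  have le_1: "c \<le> 1" for c :: 'a by (simp add: one_eq_top)
  show "a * b \<le> a" using rl_mult_mono[OF le_1, of b a] by (simp add: mult.commute)
  show "a * b \<le> b" using rl_mult_mono[OF le_1, of a b] by simp
qed

lemma rl_cong_iff:
  assumes "rl_filter F"
  shows "(x, y) \<in> rl_cong F \<longleftrightarrow> (\<exists>a\<in>F. a * x \<le> y \<and> a * y \<le> x)"
proof
  assume "(x, y) \<in> rl_cong F"
  then have "res_iff x y \<in> F" by (simp add: rl_cong_def)
  moreover have "res_iff x y * x \<le> y" "res_iff x y * y \<le> x"
    by (simp_all add: residuation[symmetric] res_iff_def)
  ultimately show "\<exists>a\<in>F. a * x \<le> y \<and> a * y \<le> x" by blast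
next
  assume "\<exists>a\<in>F. a * x \<le> y \<and> a * y \<le> x"
  then obtain a where "a \<in> F" "a \<le> res_iff x y"
    by (auto simp: residuation[symmetric] res_iff_def)
  then show "(x, y) \<in> rl_cong F"
    using assms by (auto simp: rl_cong_def rl_filter_def)
qed

lemma rl_cong_equiv:
  assumes F: "rl_filter F"
  shows "equiv UNIV (rl_cong F)"
proof (rule equivI)
  show "refl (rl_cong F)"
  proof (rule refl_onI)
    fix x
    obtain a where "a \<in> F" using F by (auto simp: rl_filter_def)
    then show "(x, x) \<in> rl_cong F" using F rl_mult_le(2) by (auto simp: rl_cong_iff)
  qed
  show "sym (rl_cong F)"
    using F by (auto simp: sym_def rl_cong_iff)
  show "trans (rl_cong F)"
  proof (rule transI)
    fix x y z assume "(x, y) \<in> rl_cong F" "(y, z) \<in> rl_cong F"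
    then obtain a b where ab: "a \<in> F" "b \<in> F" "a * x \<le> y" "a * y \<le> x" "b * y \<le> z" "b * z \<le> y"
      using F by (auto simp: rl_cong_iff)
    have "a * b * x \<le> z"
      using rl_mult_mono[OF ab(3), of b] ab(5) by (simp add: ac_simps)
    moreover have "a * b * z \<le> x"
      using rl_mult_mono[OF ab(6), of a] ab(4) by (simp add: ac_simps)
    moreover have "a * b \<in> F" using F ab by (auto simp: rl_filter_def)
    ultimately show "(x, z) \<in> rl_cong F" using F by (auto simp: rl_cong_iff)
  qed
qed simp

lemma rl_mult_sup_le:
  fixes c x y z :: "'a::residuated_lattice"
  assumes "c * x \<le> z" "c * y \<le> z"
  shows "c * sup x y \<le> z"
proof -
  have "x \<le> c \<leadsto> z" "y \<le> c \<leadsto> z" using assms by (simp_all add: residuation mult.commute)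
  then have "sup x y \<le> c \<leadsto> z" by simp
  then show ?thesis by (simp add: residuation mult.commute)
qed

lemma rl_cong_compatible:
  assumes F: "rl_filter F" and xy: "(x, x') \<in> rl_cong F" "(y, y') \<in> rl_cong F"
  shows "(sup x y, sup x' y') \<in> rl_cong F" and "(inf x y, inf x' y') \<in> rl_cong F"
proof -
  obtain a b where ab: "a \<in> F" "b \<in> F" "a * x \<le> x'" "a * x' \<le> x" "b * y \<le> y'" "b * y' \<le> y"
    using F xy by (auto simp: rl_cong_iff)
  define c where "c = a * b"
  have c: "c \<in> F" using F ab by (auto simp: rl_filter_def c_def)
  have ca: "c \<le> a" and cb: "c \<le> b" unfolding c_def by (rule rl_mult_le)+
  have le: "c * x \<le> x'" "c * x' \<le> x" "c * y \<le> y'" "c * y' \<le> y"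
    using ab(3-6) rl_mult_mono[OF ca] rl_mult_mono[OF cb] by (blast intro: order_trans)+
  have "c * sup x y \<le> sup x' y'" "c * sup x' y' \<le> sup x y"
    using le by (auto intro!: rl_mult_sup_le intro: le_supI1 le_supI2)
  then show "(sup x y, sup x' y') \<in> rl_cong F" using F c by (auto simp: rl_cong_iff)
  have m: "c * inf u v \<le> c * u" "c * inf u v \<le> c * v" for u v
    using rl_mult_mono[of "inf u v" u c] rl_mult_mono[of "inf u v" v c]
    by (simp_all add: mult.commute)
  have "c * inf x y \<le> inf x' y'" "c * inf x' y' \<le> inf x y"
    using le m by (meson le_infI order_trans)+
  then show "(inf x y, inf x' y') \<in> rl_cong F" using F c by (auto simp: rl_cong_iff)
qed

end

theory Submission
  imports Defs
begin

text \<open>The map \<open>\<lambda>\<close> respects the congruences modulo \<open>F\<close> and \<open>\<lambda>(F)\<close>, but it does not reflect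
  them, because it identifies \<open>x\<close> with each of its powers \<open>x\<^sup>n\<close>, \<open>n \<noteq> 0\<close>. On complemented
  elements this loss is harmless, for two reasons.

  First, if \<open>\<lambda>(x)\<close> and \<open>\<lambda>(y)\<close> are complementary modulo \<open>\<lambda>(F)\<close>, then \<open>x \<or> y \<in> F\<close> and
  \<open>(f x y)\<^sup>n = 0\<close> for some \<open>f \<in> F\<close>. From \<open>x \<or> y \<in> F\<close> it follows that \<open>x\<^sup>n \<or> y\<^sup>n \<in> F\<close>, so that
  \<open>x\<^sup>n\<close> and \<open>y\<^sup>n\<close> are complementary modulo \<open>F\<close> (\<open>reticulation_complements_mod_iff\<close>). Thus
  every complemented class of \<open>L/\<lambda>(F)\<close> is the image of one of \<open>A/F\<close>. The same statement for
  the filter \<open>{1}\<close> compares the Boolean centers of \<open>A\<close> and \<open>L\<close>.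

  Second, an element that is complemented modulo \<open>F\<close> is idempotent modulo \<open>F\<close>
  (\<open>complements_mod_le_power\<close>), and so the exponents produced by \<open>\<lambda>\<close> can be removed again. This
  turns a congruence \<open>\<lambda>(x) \<equiv> \<lambda>(e)\<close> between images of such elements into \<open>x \<equiv> e\<close>.\<close>

section \<open>Products, joins and powers in residuated lattices\<close>

lemma rl_mult_mono2:
  fixes a b c d :: "'a::residuated_lattice"
  assumes "a \<le> b" "c \<le> d"
  shows "a * c \<le> b * d"
proof (rule order_trans)
  show "a * c \<le> b * c" by (rule rl_mult_mono[OF assms(1)])
  show "b * c \<le> b * d" using rl_mult_mono[OF assms(2), of b] by (simp add: mult.commute)
qed

lemma rl_mult_bot: "a * bot = (bot::'a::residuated_lattice)"
  by (rule antisym[OF rl_mult_le(2) bot_least])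

lemma rl_power_le:
  fixes a :: "'a::residuated_lattice"
  assumes "n \<noteq> 0"
  shows "a ^ n \<le> a"
  using assms by (cases n) (simp_all add: rl_mult_le)

lemma rl_filter_power:
  assumes "rl_filter F" "a \<in> F"
  shows "a ^ n \<in> F"
proof (induction n)
  case 0
  have "a \<le> 1" by (simp add: one_eq_top)
  then show ?case using assms by (auto simp: rl_filter_def)
next
  case (Suc n)
  then show ?case using assms by (simp add: rl_filter_def)
qed

text \<open>Modulo \<open>F\<close> the hypotheses read \<open>u \<or> w = 1 = v \<or> w\<close>; the claim holds because
  \<open>(u \<or> w) (v \<or> w) \<le> u v \<or> w\<close>.\<close>

lemma rl_filter_sup_mult:
  assumes F: "rl_filter F" and uw: "sup u w \<in> F" and vw: "sup v w \<in> F"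
  shows "sup (u * v) w \<in> F"
proof -
  let ?t = "sup (u * v) w"
  have "u * sup v w \<le> ?t"
    by (intro rl_mult_sup_le) (simp_all add: le_supI2 rl_mult_le)
  moreover have "w * sup v w \<le> ?t"
    by (rule le_supI2[OF rl_mult_le(1)])
  ultimately have "sup v w * sup u w \<le> ?t"
    by (intro rl_mult_sup_le) (simp_all add: mult.commute)
  then show ?thesis using F uw vw by (auto simp: rl_filter_def)
qed

lemma rl_filter_sup_power_left:
  assumes F: "rl_filter F" and "sup x y \<in> F"
  shows "sup (x ^ n) y \<in> F"
proof (induction n)
  case 0
  have "x ^ 0 \<in> F" using F rl_filter_power[OF F assms(2), of 0] by simp
  then show ?case using F by (auto simp: rl_filter_def)
next
  case (Suc n)
  then show ?case using rl_filter_sup_mult[OF F assms(2)] by simp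
qed

lemma rl_filter_sup_power:
  assumes "rl_filter F" "sup x y \<in> F"
  shows "sup (x ^ n) (y ^ n) \<in> F"
  using rl_filter_sup_power_left[OF assms(1), of y "x ^ n" n]
    rl_filter_sup_power_left[OF assms, of n] by (simp add: sup.commute)

section \<open>Complements modulo a filter\<close>

text \<open>This expresses that \<open>x/F\<close> and \<open>y/F\<close> are complementary, with the product in place of the
  meet: products are compatible with powers and with \<open>\<lambda>\<close>, and \<open>x \<or> y = 1\<close> forces
  \<open>x \<and> y = x y\<close>.\<close>

definition rl_complements_mod :: "'a::residuated_lattice set \<Rightarrow> 'a \<Rightarrow> 'a \<Rightarrow> bool" where
  "rl_complements_mod F x y \<longleftrightarrow> sup x y \<in> F \<and> (\<exists>f\<in>F. f * (x * y) = bot)"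

definition lat_complements_mod ::
  "'b::{distrib_lattice, bounded_lattice} set \<Rightarrow> 'b \<Rightarrow> 'b \<Rightarrow> bool" where
  "lat_complements_mod G u v \<longleftrightarrow> sup u v \<in> G \<and> (\<exists>g\<in>G. inf g (inf u v) = bot)"

text \<open>If \<open>x \<or> y\<close> lies in a filter, then this bound makes \<open>x \<and> y\<close> and \<open>x y\<close> congruent; it
  holds because each of \<open>x (x \<and> y)\<close> and \<open>y (x \<and> y)\<close> is at most \<open>x y\<close>.\<close>

lemma rl_sup_mult_inf_le: "sup x y * inf x y \<le> x * (y::'a::residuated_lattice)"
proof -
  have "inf x y * x \<le> x * y" "inf x y * y \<le> x * y"
    using rl_mult_mono[of "inf x y" y x] rl_mult_mono[of "inf x y" x y]
    by (simp_all add: mult.commute)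
  then have "inf x y * sup x y \<le> x * y" by (rule rl_mult_sup_le)
  then show ?thesis by (simp add: mult.commute)
qed

lemma rl_cong_complements_iff:
  assumes F: "rl_filter F"
  shows "(sup x y, top) \<in> rl_cong F \<and> (inf x y, bot) \<in> rl_cong F \<longleftrightarrow> rl_complements_mod F x y"
proof -
  have top: "(z, top) \<in> rl_cong F \<longleftrightarrow> z \<in> F" for z
  proof
    assume "(z, top) \<in> rl_cong F"
    then obtain a where "a \<in> F" "a * top \<le> z" using F by (auto simp: rl_cong_iff)
    then show "z \<in> F" using F by (auto simp: rl_filter_def one_eq_top[symmetric])
  next
    assume "z \<in> F"
    then show "(z, top) \<in> rl_cong F"
      using F by (auto simp: rl_cong_iff rl_mult_le intro!: bexI[of _ z])
  qed
  have bot: "(z, bot) \<in> rl_cong F \<longleftrightarrow> (\<exists>f\<in>F. f * z = bot)" for z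
    using F by (auto simp: rl_cong_iff rl_mult_bot bot_unique)
  have "(\<exists>f\<in>F. f * inf x y = bot) \<longleftrightarrow> (\<exists>f\<in>F. f * (x * y) = bot)" if s: "sup x y \<in> F"
  proof
    assume "\<exists>f\<in>F. f * inf x y = bot"
    then obtain f where f: "f \<in> F" "f * inf x y = bot" by blast
    have "f * (x * y) \<le> f * inf x y"
      by (intro rl_mult_mono2) (simp_all add: rl_mult_le)
    then show "\<exists>f\<in>F. f * (x * y) = bot" using f by (auto simp: bot_unique)
  next
    assume "\<exists>f\<in>F. f * (x * y) = bot"
    then obtain f where f: "f \<in> F" "f * (x * y) = bot" by blast
    have "f * (sup x y * inf x y) \<le> f * (x * y)"
      by (intro rl_mult_mono2 rl_sup_mult_inf_le order_refl)
    then have "(f * sup x y) * inf x y = bot" using f by (simp add: mult.assoc bot_unique)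
    moreover have "f * sup x y \<in> F" using F f s by (simp add: rl_filter_def)
    ultimately show "\<exists>f\<in>F. f * inf x y = bot" by blast
  qed
  then show ?thesis by (auto simp: top bot rl_complements_mod_def)
qed

lemma lat_cong_complements_iff:
  assumes G: "lat_filter G"
  shows "(sup u v, top) \<in> lat_cong G \<and> (inf u v, bot) \<in> lat_cong G
    \<longleftrightarrow> lat_complements_mod G u v"
proof -
  have "(z, top) \<in> lat_cong G \<longleftrightarrow> z \<in> G" for z
    using G by (auto simp: lat_cong_def lat_filter_def inf.absorb_iff2 intro!: bexI[of _ z])
  moreover have "(z, bot) \<in> lat_cong G \<longleftrightarrow> (\<exists>g\<in>G. inf g z = bot)" for z
    by (auto simp: lat_cong_def inf.commute)
  ultimately show ?thesis by (simp add: lat_complements_mod_def)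
qed

lemma rl_filter_top: "rl_filter {top :: 'a::residuated_lattice}"
  by (simp add: rl_filter_def top_unique) (metis mult_1_left one_eq_top)

lemma rl_boolean_center_iff:
  "(x::'a::residuated_lattice) \<in> boolean_center \<longleftrightarrow> (\<exists>y. rl_complements_mod {top} x y)"
proof -
  have "(a, b) \<in> rl_cong {top} \<longleftrightarrow> a = b" for a b :: 'a
    unfolding rl_cong_iff[OF rl_filter_top] by (auto simp flip: one_eq_top)
  then show ?thesis
    unfolding rl_cong_complements_iff[OF rl_filter_top, symmetric]
    by (simp add: boolean_center_def complemented_elements_def)
qed

lemma lat_boolean_center_iff:
  "(u::'b::{distrib_lattice, bounded_lattice}) \<in> boolean_center
    \<longleftrightarrow> (\<exists>v. lat_complements_mod {top} u v)"
  by (simp add: boolean_center_def complemented_elements_def lat_complements_mod_def)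

text \<open>In \<open>A/F\<close>, multiplying \<open>x \<or> y = 1\<close> by \<open>x\<close> yields \<open>x = x\<^sup>2 \<or> x y = x\<^sup>2\<close>: complemented
  elements are idempotent.\<close>

lemma complements_mod_le_power:
  assumes F: "rl_filter F" and xy: "rl_complements_mod F x y"
  shows "\<exists>g\<in>F. g * x \<le> x ^ n"
proof -
  obtain f where f: "f \<in> F" "f * (x * y) = bot" and s: "sup x y \<in> F"
    using xy by (auto simp: rl_complements_mod_def)
  have "(f * x) * x \<le> x * x" "(f * x) * y \<le> x * x"
    using f rl_mult_le(2)[of f "x * x"] by (simp_all add: mult.assoc)
  then have sq: "(f * x) * sup x y \<le> x * x" by (rule rl_mult_sup_le)
  define h where "h = f * sup x y"
  have h: "h \<in> F" "h * x \<le> x * x"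
    using F f s sq by (simp_all add: h_def rl_filter_def ac_simps)
  show ?thesis
  proof (induction n)
    case 0
    then show ?case using h by (auto simp: one_eq_top)
  next
    case (Suc n)
    then obtain g where g: "g \<in> F" "g * x \<le> x ^ n" by blast
    have "g * (h * x) \<le> g * (x * x)" by (intro rl_mult_mono2 h order_refl)
    also have "\<dots> = (g * x) * x" by (simp add: ac_simps)
    also have "\<dots> \<le> x ^ n * x" using g(2) by (rule rl_mult_mono)
    finally have "(g * h) * x \<le> x ^ Suc n" by (simp add: ac_simps)
    moreover have "g * h \<in> F" using F g h by (simp add: rl_filter_def)
    ultimately show ?case by blast
  qed
qed

section \<open>Boolean lifting in terms of representatives\<close>

text \<open>Boolean elements always have complemented classes, so lifting is the reverse inclusion;
  it can be tested on representatives.\<close>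

lemma lifts_boolean_center_iff:
  fixes \<theta> :: "'a::bounded_lattice rel"
  assumes eq: "equiv UNIV \<theta>"
    and sup: "\<And>x x' y y'. (x, x') \<in> \<theta> \<Longrightarrow> (y, y') \<in> \<theta> \<Longrightarrow> (sup x y, sup x' y') \<in> \<theta>"
    and inf: "\<And>x x' y y'. (x, x') \<in> \<theta> \<Longrightarrow> (y, y') \<in> \<theta> \<Longrightarrow> (inf x y, inf x' y') \<in> \<theta>"
  shows "lifts_boolean_center \<theta> \<longleftrightarrow>
    (\<forall>x y. (sup x y, top) \<in> \<theta> \<and> (inf x y, bot) \<in> \<theta> \<longrightarrow> (\<exists>e\<in>boolean_center. (x, e) \<in> \<theta>))"
proof -
  have cl: "\<theta> `` {x} = \<theta> `` {y} \<longleftrightarrow> (x, y) \<in> \<theta>" for x y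
    using eq_equiv_class_iff[OF eq] by simp
  have quot: "UNIV // \<theta> = range (\<lambda>x. \<theta> `` {x})" by (auto simp: quotient_def)
  have mem: "\<theta> `` {x} \<in> (\<lambda>e. \<theta> `` {e}) ` boolean_center
      \<longleftrightarrow> (\<exists>e\<in>boolean_center. (x, e) \<in> \<theta>)"
    for x by (simp add: image_iff cl)
  have refl: "(z, z) \<in> \<theta>" for z
    using eq by (auto simp: equiv_def refl_on_def)
  have center: "quot_boolean_center \<theta> =
      {\<theta> `` {x} | x. \<exists>y. (sup x y, top) \<in> \<theta> \<and> (inf x y, bot) \<in> \<theta>}"
    unfolding quot_boolean_center_def complemented_elements_def quot
    by (auto simp: quot_op_class[OF eq sup] quot_op_class[OF eq inf] cl) (blast intro: refl)
  have "(\<lambda>e. \<theta> `` {e}) ` boolean_center \<subseteq> quot_boolean_center \<theta>"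
  proof
    fix X assume "X \<in> (\<lambda>e. \<theta> `` {e}) ` boolean_center"
    then obtain e e' where "X = \<theta> `` {e}" "sup e e' = top" "inf e e' = bot"
      by (auto simp: boolean_center_def complemented_elements_def)
    then show "X \<in> quot_boolean_center \<theta>"
      unfolding center mem_Collect_eq using refl by metis
  qed
  then have "lifts_boolean_center \<theta> \<longleftrightarrow>
      quot_boolean_center \<theta> \<subseteq> (\<lambda>e. \<theta> `` {e}) ` boolean_center"
    by (auto simp: lifts_boolean_center_def)
  also have "\<dots> \<longleftrightarrow>
      (\<forall>x y. (sup x y, top) \<in> \<theta> \<and> (inf x y, bot) \<in> \<theta> \<longrightarrow> (\<exists>e\<in>boolean_center. (x, e) \<in> \<theta>))"
    unfolding center mem[symmetric] by blast
  finally show ?thesis .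
qed

lemma rl_BLP_iff:
  assumes F: "rl_filter F"
  shows "rl_BLP F \<longleftrightarrow>
    (\<forall>x y. rl_complements_mod F x y \<longrightarrow> (\<exists>e\<in>boolean_center. (x, e) \<in> rl_cong F))"
  unfolding rl_BLP_def rl_cong_complements_iff[OF F, symmetric]
  by (rule lifts_boolean_center_iff[OF rl_cong_equiv[OF F]])
    (erule (1) rl_cong_compatible[OF F])+

lemma lat_BLP_iff:
  assumes G: "lat_filter G"
  shows "lat_BLP G \<longleftrightarrow>
    (\<forall>u v. lat_complements_mod G u v \<longrightarrow> (\<exists>e\<in>boolean_center. (u, e) \<in> lat_cong G))"
  unfolding lat_BLP_def lat_cong_complements_iff[OF G, symmetric]
  by (rule lifts_boolean_center_iff[OF lat_cong_equiv[OF G]])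
    (erule (1) lat_cong_compatible[OF G])+

section \<open>Transfer along the reticulation\<close>

context
  fixes lam :: "'a::residuated_lattice \<Rightarrow> 'b::{distrib_lattice, bounded_lattice}"
  assumes ret: "is_reticulation lam"
begin

lemma reticulation_simps:
  "lam (a * b) = inf (lam a) (lam b)" "lam (sup a b) = sup (lam a) (lam b)"
  "lam bot = bot" "lam top = top"
  using ret by (simp_all add: is_reticulation_def)

lemma reticulation_le_iff: "lam a \<le> lam b \<longleftrightarrow> (\<exists>n. n \<noteq> 0 \<and> a ^ n \<le> b)"
  using ret by (simp add: is_reticulation_def)

lemma reticulation_mono: "a \<le> b \<Longrightarrow> lam a \<le> lam b"
  unfolding reticulation_le_iff by (rule exI[of _ 1]) simp

lemma reticulation_power: "n \<noteq> 0 \<Longrightarrow> lam (a ^ n) = lam a"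
  by (rule antisym) (auto simp: reticulation_mono rl_power_le reticulation_le_iff[of a])

lemma reticulation_surj: obtains x where "u = lam x"
  using ret by (metis is_reticulation_def surjD)

lemma reticulation_mem_iff:
  assumes F: "rl_filter F"
  shows "lam x \<in> lam ` F \<longleftrightarrow> x \<in> F"
proof
  assume "lam x \<in> lam ` F"
  then obtain f where "f \<in> F" "lam f \<le> lam x" by auto
  then obtain n where "f ^ n \<in> F" "f ^ n \<le> x"
    using rl_filter_power[OF F] by (auto simp: reticulation_le_iff)
  then show "x \<in> F" using F by (auto simp: rl_filter_def)
qed simp

lemma reticulation_filter:
  assumes F: "rl_filter F"
  shows "lat_filter (lam ` F)"
  unfolding lat_filter_def
proof (intro conjI ballI allI impI)
  show "lam ` F \<noteq> {}" using F by (simp add: rl_filter_def)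
next
  fix u v assume "u \<in> lam ` F" "v \<in> lam ` F"
  then obtain a b where "u = lam a" "v = lam b" "a * b \<in> F"
    using F by (auto simp: rl_filter_def)
  then show "inf u v \<in> lam ` F" by (auto simp: reticulation_simps(1)[symmetric])
next
  fix u v assume "u \<in> lam ` F" "u \<le> v"
  then obtain f where f: "f \<in> F" "lam f \<le> v" by auto
  obtain x where x: "v = lam x" by (rule reticulation_surj)
  have "sup f x \<in> F" using F f by (auto simp: rl_filter_def)
  moreover have "lam (sup f x) = v" using f x by (simp add: reticulation_simps sup.absorb2)
  ultimately show "v \<in> lam ` F" by blast
qed

text \<open>The exponent is needed because \<open>\<lambda>(f x y) = 0\<close> only says that \<open>f x y\<close> is nilpotent. Passing
  to powers does not spoil the condition on the join, by \<open>rl_filter_sup_power\<close>.\<close>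

lemma reticulation_complements_mod_iff:
  assumes F: "rl_filter F"
  shows "lat_complements_mod (lam ` F) (lam x) (lam y)
    \<longleftrightarrow> (\<exists>n. n \<noteq> 0 \<and> rl_complements_mod F (x ^ n) (y ^ n))"
proof
  assume "lat_complements_mod (lam ` F) (lam x) (lam y)"
  then obtain f where s: "sup x y \<in> F" and f: "f \<in> F" "lam (f * (x * y)) \<le> lam bot"
    by (auto simp: lat_complements_mod_def reticulation_simps
        reticulation_mem_iff[OF F, of "sup x y", unfolded reticulation_simps])
  then obtain n where n: "n \<noteq> 0" "f ^ n * (x ^ n * y ^ n) = bot"
    by (auto simp: reticulation_le_iff bot_unique power_mult_distrib)
  then have "rl_complements_mod F (x ^ n) (y ^ n)"
    using rl_filter_sup_power[OF F s] rl_filter_power[OF F f(1)]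
    by (auto simp: rl_complements_mod_def)
  then show "\<exists>n. n \<noteq> 0 \<and> rl_complements_mod F (x ^ n) (y ^ n)" using n by blast
next
  assume "\<exists>n. n \<noteq> 0 \<and> rl_complements_mod F (x ^ n) (y ^ n)"
  then obtain n f where n: "n \<noteq> 0" and s: "sup (x ^ n) (y ^ n) \<in> F"
    and f: "f \<in> F" "f * (x ^ n * y ^ n) = bot"
    by (auto simp: rl_complements_mod_def)
  have "inf (lam f) (inf (lam x) (lam y)) = bot"
    using arg_cong[OF f(2), of lam] n by (simp add: reticulation_simps reticulation_power)
  moreover have "sup (lam x) (lam y) \<in> lam ` F"
    using imageI[OF s, of lam] n by (simp add: reticulation_simps reticulation_power)
  ultimately show "lat_complements_mod (lam ` F) (lam x) (lam y)"
    using f(1) by (auto simp: lat_complements_mod_def)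
qed

text \<open>Since \<open>\<lambda>(x\<^sup>n) = \<lambda>(x)\<close>, the Boolean elements of \<open>L\<close> are exactly the images of those
  of \<open>A\<close>.\<close>

lemma reticulation_boolean_center: "lam ` boolean_center = boolean_center"
proof -
  note iff = reticulation_complements_mod_iff[OF rl_filter_top, simplified reticulation_simps
      image_insert image_empty]
  show ?thesis
  proof (intro equalityI subsetI)
    fix u assume "u \<in> lam ` boolean_center"
    then obtain e y where "u = lam e" "rl_complements_mod {top} (e ^ 1) (y ^ 1)"
      by (auto simp: rl_boolean_center_iff)
    then show "u \<in> boolean_center"
      using iff[of e y] by (auto simp: lat_boolean_center_iff simp del: power_one_right)
  next
    fix u :: 'b assume "u \<in> boolean_center"
    then obtain v where uv: "lat_complements_mod {top} u v"
      by (auto simp: lat_boolean_center_iff)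
    obtain x where x: "u = lam x" by (rule reticulation_surj)
    obtain y where y: "v = lam y" by (rule reticulation_surj)
    obtain n where n: "n \<noteq> 0" "rl_complements_mod {top} (x ^ n) (y ^ n)"
      using uv x y iff by blast
    then have "x ^ n \<in> boolean_center" by (auto simp: rl_boolean_center_iff)
    moreover have "u = lam (x ^ n)" using x n by (simp add: reticulation_power)
    ultimately show "u \<in> lam ` boolean_center" by blast
  qed
qed

lemma reticulation_cong:
  assumes F: "rl_filter F" and xy: "(x, y) \<in> rl_cong F"
  shows "(lam x, lam y) \<in> lat_cong (lam ` F)"
proof -
  obtain f where f: "f \<in> F" "f * x \<le> y" "f * y \<le> x" using F xy by (auto simp: rl_cong_iff)
  have "inf (lam f) (lam x) \<le> lam y" "inf (lam f) (lam y) \<le> lam x"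
    using f(2,3)[THEN reticulation_mono] by (simp_all add: reticulation_simps)
  then have "inf (lam x) (lam f) = inf (lam y) (lam f)"
    by (intro antisym) (simp_all add: inf.commute)
  then show ?thesis using f(1) by (auto simp: lat_cong_def)
qed

text \<open>A partial converse: \<open>\<lambda>(x f) \<le> \<lambda>(y)\<close> only gives \<open>(x f)\<^sup>n \<le> y\<close>, and
  the exponent of \<open>x\<close> is absorbed because \<open>x\<close> is idempotent modulo \<open>F\<close>.\<close>

lemma complemented_le_mod_if_reticulation_le:
  assumes F: "rl_filter F" and x: "rl_complements_mod F x x'" and f: "f \<in> F"
    and le: "inf (lam x) (lam f) \<le> lam y"
  shows "\<exists>g\<in>F. g * x \<le> y"
proof -
  obtain n where n: "x ^ n * f ^ n \<le> y"
    using le by (auto simp: reticulation_simps(1)[symmetric] reticulation_le_iff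
        power_mult_distrib)
  obtain g where g: "g \<in> F" "g * x \<le> x ^ n"
    using complements_mod_le_power[OF F x] by blast
  have "(g * f ^ n) * x \<le> y"
    using rl_mult_mono[OF g(2), of "f ^ n"] n by (simp add: ac_simps)
  moreover have "g * f ^ n \<in> F"
    using F g rl_filter_power[OF F f] by (simp add: rl_filter_def)
  ultimately show ?thesis by blast
qed

lemma rl_cong_if_reticulation_cong:
  assumes F: "rl_filter F" and x: "rl_complements_mod F x x'" and y: "rl_complements_mod F y y'"
    and xy: "(lam x, lam y) \<in> lat_cong (lam ` F)"
  shows "(x, y) \<in> rl_cong F"
proof -
  obtain f where f: "f \<in> F" "inf (lam x) (lam f) = inf (lam y) (lam f)"
    using xy by (auto simp: lat_cong_def)
  then have "inf (lam x) (lam f) \<le> lam y" "inf (lam y) (lam f) \<le> lam x"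
    by (simp, metis inf.cobounded1)
  then obtain g h where gh: "g \<in> F" "g * x \<le> y" "h \<in> F" "h * y \<le> x"
    using complemented_le_mod_if_reticulation_le[OF F x f(1)]
      complemented_le_mod_if_reticulation_le[OF F y f(1)] by blast
  have "(g * h) * x \<le> y" "(g * h) * y \<le> x"
    using rl_mult_mono[OF rl_mult_le(1)[of g h], of x] rl_mult_mono[OF rl_mult_le(2)[of g h], of y]
      gh by (blast intro: order_trans)+
  moreover have "g * h \<in> F" using F gh by (simp add: rl_filter_def)
  ultimately show ?thesis using F by (auto simp: rl_cong_iff)
qed

end

section \<open>The equivalence of the two lifting properties\<close>

theorem proposition5p18:
  fixes lam :: "'a::residuated_lattice \<Rightarrow> 'b::{distrib_lattice, bounded_lattice}"
    and F :: "'a set"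
  assumes "is_reticulation lam"
    and "rl_filter F"
  shows "rl_BLP F \<longleftrightarrow> lat_BLP (lam ` F)"
proof -
  note ret = assms(1) and F = assms(2)
  note G = reticulation_filter[OF ret F]
  show ?thesis
  proof
    assume A: "rl_BLP F"
    show "lat_BLP (lam ` F)"
      unfolding lat_BLP_iff[OF G]
    proof (intro allI impI)
      fix u v assume uv: "lat_complements_mod (lam ` F) u v"
      obtain x where x: "u = lam x" by (rule reticulation_surj[OF ret])
      obtain y where y: "v = lam y" by (rule reticulation_surj[OF ret])
      obtain n where n: "n \<noteq> 0" "rl_complements_mod F (x ^ n) (y ^ n)"
        using uv x y reticulation_complements_mod_iff[OF ret F] by blast
      then obtain e where e: "e \<in> boolean_center" "(x ^ n, e) \<in> rl_cong F"
        using A rl_BLP_iff[OF F] by blast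
      have "(u, lam e) \<in> lat_cong (lam ` F)"
        using reticulation_cong[OF ret F e(2)] x n by (simp add: reticulation_power[OF ret])
      moreover have "lam e \<in> boolean_center"
        using e(1) reticulation_boolean_center[OF ret] by blast
      ultimately show "\<exists>e\<in>boolean_center. (u, e) \<in> lat_cong (lam ` F)" by blast
    qed
  next
    assume L: "lat_BLP (lam ` F)"
    show "rl_BLP F"
      unfolding rl_BLP_iff[OF F]
    proof (intro allI impI)
      fix x y assume xy: "rl_complements_mod F x y"
      then have "rl_complements_mod F (x ^ 1) (y ^ 1)" by simp
      then have "lat_complements_mod (lam ` F) (lam x) (lam y)"
        using reticulation_complements_mod_iff[OF ret F] one_neq_zero by blast
      then obtain u where u: "u \<in> boolean_center" "(lam x, u) \<in> lat_cong (lam ` F)"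
        using L lat_BLP_iff[OF G] by blast
      then obtain e where e: "e \<in> boolean_center" "(lam x, lam e) \<in> lat_cong (lam ` F)"
        unfolding reticulation_boolean_center[OF ret, symmetric] by auto
      obtain e' where "rl_complements_mod {top} e e'"
        using e(1) by (auto simp: rl_boolean_center_iff)
      moreover have "top \<in> F" using F by (auto simp: rl_filter_def)
      ultimately have "rl_complements_mod F e e'" by (auto simp: rl_complements_mod_def)
      then have "(x, e) \<in> rl_cong F" using rl_cong_if_reticulation_cong[OF ret F xy] e(2) by blast
      then show "\<exists>e\<in>boolean_center. (x, e) \<in> rl_cong F" using e(1) by blast
    qed
  qed
qed

end
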